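(* For every $K_3N$ $n=pqr$, $q<\sqrt{\dfrac np}-\sqrt{\dfrac p{12}}$.
   Context: A $K_3N$ (Korselt number with three factors) is an integer $n$ together with a factorisation $n=pqr$, where $1<p<q<r$ are odd integers (not necessarily prime) such that each of $p-1,\ q-1,\ r-1$ divides $n-1$, and such that $E:=\dfrac{pq-1}{r-1}$ (which is an integer by the divisibility condition) satisfies $E\ge 2$. *)

theory Defs
  imports Complex_Main
begin

definition korselt_E :: "int \<Rightarrow> int \<Rightarrow> int \<Rightarrow> int" where
  "korselt_E p q r = (p * q - 1) div (r - 1)"

text \<open>
  The three factors are not required to be prime. The factorisation is part of the data, so
  the factors are arguments of the predicate.
\<close>

definition K3N :: "int \<Rightarrow> int \<Rightarrow> int \<Rightarrow> int \<Rightarrow> bool" where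
  "K3N n p q r \<longleftrightarrow>
     n = p * q * r \<and>
     1 < p \<and> p < q \<and> q < r \<and>
     odd p \<and> odd q \<and> odd r \<and>
     (p - 1) dvd (n - 1) \<and> (q - 1) dvd (n - 1) \<and> (r - 1) dvd (n - 1) \<and>
     korselt_E p q r \<ge> 2"

text \<open>The integer division defining \<open>korselt_E\<close> is exact on every Korselt number.\<close>

lemma K3N_korselt_E_exact:
  assumes "K3N n p q r"
  shows "korselt_E p q r * (r - 1) = p * q - 1"
    and "real_of_int (korselt_E p q r) = (real_of_int p * real_of_int q - 1) / (real_of_int r - 1)"
proof -
  have n: "n = p * q * r" and dvd: "(r - 1) dvd (n - 1)" and r: "r > 1"
    using assms by (auto simp: K3N_def)
  have "p * q - 1 = (n - 1) - p * q * (r - 1)"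
    unfolding n by (simp add: algebra_simps)
  then have "(r - 1) dvd (p * q - 1)"
    using dvd by (metis dvd_diff dvd_triv_right)
  then show *: "korselt_E p q r * (r - 1) = p * q - 1"
    unfolding korselt_E_def by simp
  have "real_of_int (korselt_E p q r) * (real_of_int r - 1) = real_of_int p * real_of_int q - 1"
    using arg_cong[OF *, of real_of_int] by simp
  then show "real_of_int (korselt_E p q r) =
      (real_of_int p * real_of_int q - 1) / (real_of_int r - 1)"
    using r by (simp add: field_simps)
qed

end

theory Submission
  imports Defs
begin

text \<open>
  Write \<open>D = (p r - 1)/(q - 1) = p + x\<close>, \<open>E = p - y\<close>, \<open>d = r - q\<close> and \<open>C = D E - p\<^sup>2\<close>, so that
  \<open>C = p (x - y) - x y\<close>. Eliminating \<open>q\<close> and \<open>r\<close> gives \<open>(q - 1) C = (p - 1) (2 p - y)\<close> and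
  \<open>d C = (p - 1) (x + y)\<close>, and the claim follows from \<open>4 p \<le> 11 d\<^sup>2\<close>.
  Since \<open>q > p\<close> forces \<open>C < 2 p\<close>, this is a matter of size if \<open>x - y \<ge> 3\<close>. If \<open>x - y\<close>
  is \<open>1\<close> or \<open>2\<close>, then the divisibility of \<open>q r - 1\<close> by \<open>p - 1\<close> becomes a congruence modulo
  \<open>C\<^sup>2\<close>, which bounds \<open>d\<close> from below.
\<close>

text \<open>\<open>A\<close> is the quotient \<open>(q * r - 1) / (p - 1)\<close>. Both
  \<open>(q - 1) * C\<close> and \<open>(r - 1) * C\<close> are polynomials in \<open>p\<close>,
  \<open>x\<close>, \<open>y\<close>, so multiplying by \<open>C\<^sup>2\<close> removes
  \<open>q\<close> and \<open>r\<close> from the divisibility by \<open>p - 1\<close>.\<close>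

lemma K3N_parameters:
  assumes "K3N n p q r"
  obtains x y C A :: int
  where "x > 0" "y > 0" "C > 0" "C = p * (x - y) - x * y" "C < 2 * p"
    "(r - q) * C = (p - 1) * (x + y)"
    "A * C\<^sup>2 = (4 * p + (x - y)) * (p\<^sup>2 - p + C) + (p - 1) * C"
proof -
  have n: "n = p * q * r" and pqr: "1 < p" "p < q" "q < r"
    and dvd: "(p - 1) dvd (n - 1)" "(q - 1) dvd (n - 1)"
    using assms by (auto simp: K3N_def)
  define E where "E = korselt_E p q r"
  have E: "E * (r - 1) = p * q - 1"
    unfolding E_def by (rule K3N_korselt_E_exact(1)[OF assms])
  have "q * r - 1 = (n - 1) - q * r * (p - 1)"
    unfolding n by (simp add: algebra_simps)
  then have "(p - 1) dvd (q * r - 1)"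
    using dvd by (metis dvd_diff dvd_triv_right)
  then obtain A where A: "q * r - 1 = (p - 1) * A" by (elim dvdE)
  have "p * r - 1 = (n - 1) - p * r * (q - 1)"
    unfolding n by (simp add: algebra_simps)
  then have "(q - 1) dvd (p * r - 1)"
    using dvd by (metis dvd_diff dvd_triv_right)
  then obtain D where D: "p * r - 1 = (q - 1) * D" by (elim dvdE)
  define x y C where "x = D - p" and "y = p - E" and "C = D * E - p\<^sup>2"
  have Deq: "D = p + x" and Eeq: "E = p - y" by (simp_all add: x_def y_def)
  have C: "C = p * (x - y) - x * y"
    unfolding C_def Deq Eeq by (simp add: algebra_simps power2_eq_square)
  have "(q - 1) * x = p * (r - q) + (p - 1)"
    using D unfolding Deq by (simp add: algebra_simps)
  moreover have "p * (r - q) > 0" using pqr by simp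
  ultimately have x: "x > 0"
    using pqr by (smt (verit) zero_less_mult_pos)
  have "(r - 1) * y = p * (r - q - 1) + 1"
    using E unfolding Eeq by (simp add: algebra_simps)
  moreover have "p * (r - q - 1) \<ge> 0" using pqr by simp
  ultimately have y: "y > 0"
    using pqr by (smt (verit) zero_less_mult_pos)
  have qC: "(q - 1) * C = (p - 1) * (2 * p - y)"
  proof -
    have "(q - 1) * C = E * ((q - 1) * D) - p\<^sup>2 * (q - 1)"
      unfolding C_def by (simp add: algebra_simps)
    also have "\<dots> = p * (E * (r - 1)) + E * (p - 1) - p\<^sup>2 * (q - 1)"
      unfolding D[symmetric] by (simp add: algebra_simps)
    also have "\<dots> = (p - 1) * (2 * p - y)"
      unfolding E unfolding Eeq by (simp add: algebra_simps power2_eq_square)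
    finally show ?thesis .
  qed
  have rC: "(r - 1) * C = (p - 1) * (2 * p + x)"
  proof -
    have "(r - 1) * C = D * (E * (r - 1)) - p\<^sup>2 * (r - 1)"
      unfolding C_def by (simp add: algebra_simps)
    also have "\<dots> = p * ((q - 1) * D) + D * (p - 1) - p\<^sup>2 * (r - 1)"
      unfolding E by (simp add: algebra_simps)
    also have "\<dots> = (p - 1) * (2 * p + x)"
      unfolding D[symmetric] unfolding Deq by (simp add: algebra_simps power2_eq_square)
    finally show ?thesis .
  qed
  have "(p - 1) * (2 * p + x) > 0" using pqr x by simp
  then have Cpos: "C > 0"
    using rC pqr by (smt (verit) zero_less_mult_pos)
  have "(p - 1) * C < (p - 1) * (2 * p)"
  proof -
    have "(p - 1) * C \<le> (q - 1) * C" using pqr Cpos by (intro mult_right_mono) auto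
    also have "\<dots> < (p - 1) * (2 * p)" unfolding qC using pqr y by simp
    finally show ?thesis .
  qed
  then have C2p: "C < 2 * p" using pqr by simp
  have dC: "(r - q) * C = (p - 1) * (x + y)"
    using qC rC by (simp add: algebra_simps)
  \<comment> \<open>This is \<open>q * r - 1 = (q - 1) * (r - 1) + (q - 1) + (r - 1)\<close> times
    \<open>C\<^sup>2\<close>.\<close>
  have "(p - 1) * (A * C\<^sup>2) = ((q - 1) * C) * ((r - 1) * C) + C * ((q - 1) * C + (r - 1) * C)"
    unfolding mult.assoc[symmetric] A[symmetric] by (simp add: algebra_simps power2_eq_square)
  also have "\<dots> = (p - 1) * ((4 * p + (x - y)) * (p\<^sup>2 - p + C) + (p - 1) * C)"
    unfolding qC rC unfolding C by (simp add: algebra_simps power2_eq_square power3_eq_cube)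
  finally have AC: "A * C\<^sup>2 = (4 * p + (x - y)) * (p\<^sup>2 - p + C) + (p - 1) * C"
    using pqr by simp
  show ?thesis by (rule that[OF x y Cpos C C2p dC AC])
qed

text \<open>The case \<open>x = y + 1\<close>. Eliminating \<open>C\<close> from the last two
  hypotheses makes \<open>w - 1\<close> divide a positive number built from \<open>e\<close> and
  \<open>F\<close>, so \<open>e\<close> cannot be too small.\<close>

lemma gap_bound_diff_1:
  fixes p d y C A :: int
  assumes y: "y > 0" and Cpos: "C > 0" and C: "C = p - y * (y + 1)"
    and dC: "d * C = (p - 1) * (2 * y + 1)"
    and AC: "A * C\<^sup>2 = (4 * p + 1) * (p\<^sup>2 - p + C) + (p - 1) * C"
  shows "4 * p \<le> 11 * d\<^sup>2"
proof -
  \<comment> \<open>\<open>F = x + y\<close> and \<open>w = x * y\<close>. Subtracting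
    \<open>F\<close> from \<open>d\<close> makes \<open>e * C\<close> free of \<open>p\<close> and
    \<open>C\<close>, since \<open>p - 1 - C = w - 1\<close>.\<close>
  define F w e where "F = 2 * y + 1" and "w = y * (y + 1)" and "e = d - F"
  have p: "p = C + w" using C by (simp add: w_def)
  have F: "F > 0" and F2: "F\<^sup>2 = 4 * w + 1"
    using y by (simp_all add: F_def w_def algebra_simps power2_eq_square)
  have w: "w > 1" using y mult_mono[of 1 y 2 "y + 1"] by (simp add: w_def)
  have eC: "e * C = (w - 1) * F"
    using dC unfolding e_def F_def[symmetric] p by (simp add: algebra_simps)
  have e: "e > 0" using eC w F Cpos by (smt (verit) mult_pos_pos zero_less_mult_pos2)
  \<comment> \<open>Put \<open>p = C + w\<close> on the right of \<open>AC\<close> and divide by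
    \<open>C\<^sup>2\<close> as polynomials in \<open>C\<close>: the quotient is
    \<open>4 * C + 12 * w + 2\<close>, and \<open>k * C\<^sup>2\<close> is the remainder.\<close>
  define k where "k = A - 4 * C - 12 * w - 2"
  have "k * C\<^sup>2 = F\<^sup>2 * (w * (w - 1) + C * (3 * w - 1))"
    using AC unfolding p k_def F2
    by (simp add: algebra_simps power2_eq_square)
  also have "\<dots> = F * w * ((w - 1) * F) + F\<^sup>2 * C * (3 * w - 1)"
    by (simp add: algebra_simps power2_eq_square)
  also have "\<dots> = C * (F * (w * e) + F\<^sup>2 * (3 * w - 1))"
    unfolding eC[symmetric] by (simp add: algebra_simps)
  finally have "k * C = F * (w * e) + F\<^sup>2 * (3 * w - 1)"
    using Cpos by (simp add: power2_eq_square)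
  \<comment> \<open>The factor \<open>e\<close> turns the last \<open>C\<close> into
    \<open>e * C\<close>, which \<open>eC\<close> replaces.\<close>
  then have "k * (e * C) = e * (F * (w * e) + F\<^sup>2 * (3 * w - 1))"
    by (simp add: mult.left_commute)
  then have "F * (k * (w - 1)) = F * (w * e * e + F * (3 * w - 1) * e)"
    unfolding eC by (simp add: algebra_simps power2_eq_square)
  then have "k * (w - 1) = w * e * e + F * (3 * w - 1) * e"
    using F by simp
  \<comment> \<open>Modulo \<open>w - 1\<close>, \<open>w\<close> is 1 and \<open>3 * w - 1\<close>
    is 2.\<close>
  then have "e * (e + 2 * F) = (w - 1) * (k - e * e - 3 * F * e)"
    by (simp add: algebra_simps)
  then have "(w - 1) dvd e * (e + 2 * F)" by (rule dvdI)
  then have "w - 1 \<le> e * (e + 2 * F)" using e F by (intro zdvd_imp_le) auto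
  then have "(w - 1) * F \<le> e * (e + 2 * F) * F" using F by simp
  then have "e * C \<le> e * ((e + 2 * F) * F)" unfolding eC by (simp add: mult.assoc)
  then have "C \<le> (e + 2 * F) * F" using e by simp
  then have "4 * p \<le> 9 * F\<^sup>2 + 4 * (e * F)"
    unfolding p using F2 by (simp add: algebra_simps power2_eq_square)
  also have "\<dots> \<le> 11 * (F\<^sup>2 + 2 * (e * F) + e\<^sup>2)" using e F by simp
  also have "\<dots> = 11 * d\<^sup>2" unfolding e_def by (simp add: algebra_simps power2_eq_square)
  finally show ?thesis .
qed

text \<open>The case \<open>x = y + 2\<close>, by the same elimination with \<open>2 * p\<close> in
  place of \<open>p\<close>. The estimate is too weak only for \<open>e = 1\<close>, where few
  values of \<open>G\<close> remain.\<close>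

lemma gap_bound_diff_2:
  fixes p d y C A :: int
  assumes y: "y > 0" and Cpos: "C > 0" and C: "C = 2 * p - y * (y + 2)"
    and dC: "d * C = (p - 1) * (2 * y + 2)"
    and AC: "A * C\<^sup>2 = (4 * p + 2) * (p\<^sup>2 - p + C) + (p - 1) * C"
  shows "4 * p \<le> 11 * d\<^sup>2"
proof -
  \<comment> \<open>Here \<open>x + y = 2 * G\<close> and
    \<open>x * y = G\<^sup>2 - 1\<close>.\<close>
  define G e where "G = y + 1" and "e = d - G"
  have p: "2 * p = C + G\<^sup>2 - 1"
    using C by (simp add: G_def algebra_simps power2_eq_square)
  have G: "G \<ge> 2" using y by (simp add: G_def)
  have G2: "G\<^sup>2 \<ge> 4" using G power_mono[of 2 G 2] by simp
  have "d * C = (2 * p - 2) * G"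
    using dC by (simp add: G_def algebra_simps)
  then have eC: "e * C = (G\<^sup>2 - 3) * G"
    unfolding e_def p by (simp add: algebra_simps)
  have e: "e > 0" using eC G G2 Cpos by (smt (verit) mult_pos_pos zero_less_mult_pos2)
  define k where "k = 2 * A - C - 3 * G\<^sup>2 - 1"
  \<comment> \<open>Doubling lets \<open>p\<close> enter only through \<open>2 * p\<close>; the
    \<open>div 2\<close> is exact, as its first factor is even.\<close>
  have "2 * A * C\<^sup>2 = (2 * (2 * p) + 2) * ((2 * p) * (2 * p - 2) + 4 * C) div 2 + (2 * p - 2) * C"
    using AC by (simp add: algebra_simps power2_eq_square)
  then have "2 * A * C\<^sup>2 = (C + G\<^sup>2) * ((C + G\<^sup>2 - 1) * (C + G\<^sup>2 - 3) + 4 * C) + (C + G\<^sup>2 - 3) * C"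
    unfolding p by (simp add: algebra_simps)
  then have "k * C\<^sup>2 = G\<^sup>2 * (G\<^sup>2 - 1) * (G\<^sup>2 - 3 + 3 * C)"
    unfolding k_def by (simp add: algebra_simps power2_eq_square)
  also have "\<dots> = G * (G\<^sup>2 - 1) * ((G\<^sup>2 - 3) * G + 3 * G * C)"
    by (simp add: algebra_simps power2_eq_square)
  also have "\<dots> = C * (G * ((G\<^sup>2 - 1) * (e + 3 * G)))"
    unfolding eC[symmetric] by (simp add: algebra_simps)
  finally have "k * C = G * ((G\<^sup>2 - 1) * (e + 3 * G))"
    using Cpos by (simp add: power2_eq_square)
  then have "k * (e * C) = e * (G * ((G\<^sup>2 - 1) * (e + 3 * G)))"
    by (simp add: mult.left_commute)
  then have "G * (k * (G\<^sup>2 - 3)) = G * ((G\<^sup>2 - 1) * (e * (e + 3 * G)))"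
    unfolding eC by (simp add: ac_simps)
  then have "k * (G\<^sup>2 - 3) = (G\<^sup>2 - 1) * (e * (e + 3 * G))"
    using G by simp
  \<comment> \<open>Modulo \<open>G\<^sup>2 - 3\<close>, the factor \<open>G\<^sup>2 - 1\<close> is
    2.\<close>
  then have "2 * (e * (e + 3 * G)) = (G\<^sup>2 - 3) * (k - e * (e + 3 * G))"
    by (simp add: algebra_simps)
  then have "(G\<^sup>2 - 3) dvd 2 * (e * (e + 3 * G))" by (rule dvdI)
  then have le: "G\<^sup>2 - 3 \<le> 2 * (e * (e + 3 * G))" using e G by (intro zdvd_imp_le) auto
  then have "(G\<^sup>2 - 3) * G \<le> 2 * (e * (e + 3 * G)) * G" using G by simp
  then have "e * C \<le> e * (2 * (e + 3 * G) * G)" unfolding eC by (simp add: algebra_simps)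
  then have "C \<le> 2 * (e + 3 * G) * G" using e by simp
  then have upper: "4 * p \<le> 14 * G\<^sup>2 + 4 * (e * G) - 2"
    using p by (simp add: algebra_simps power2_eq_square)
  have d2: "11 * d\<^sup>2 = 11 * G\<^sup>2 + 22 * (e * G) + 11 * e\<^sup>2"
    unfolding e_def by (simp add: algebra_simps power2_eq_square)
  have le': "G\<^sup>2 - 3 \<le> 2 * e\<^sup>2 + 6 * (e * G)"
    using le by (simp add: algebra_simps power2_eq_square)
  \<comment> \<open>By \<open>upper\<close> and \<open>d2\<close>, it suffices that
    \<open>3 * G\<^sup>2 - 2 \<le> 18 * (e * G) + 11 * e\<^sup>2\<close>. Three times
    \<open>le'\<close> yields this once \<open>5 * e\<^sup>2 \<ge> 7\<close>, that is, for
    \<open>e \<ge> 2\<close>.\<close>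
  show ?thesis
  proof (cases "e \<ge> 2")
    case True
    then have "e\<^sup>2 \<ge> 4" using power_mono[of 2 e 2] by simp
    then show ?thesis using upper le' d2 by linarith
  next
    case False
    then have e1: "e = 1" using e by simp
    have "G < 7"
    proof (rule ccontr)
      assume "\<not> G < 7"
      then have "7 * G \<le> G\<^sup>2" by (simp add: power2_eq_square)
      then show False using le' e1 \<open>\<not> G < 7\<close> by simp
    qed
    \<comment> \<open>With \<open>e = 1\<close>, \<open>G\<close> determines \<open>C\<close>,
      \<open>d\<close> and \<open>2 * p\<close>, so each value is checked directly.\<close>
    then have "G \<in> {2, 3, 4, 5, 6}" using G by auto
    moreover have "C = (G\<^sup>2 - 3) * G" and "d = G + 1" using eC e1 by (simp_all add: e_def)
    ultimately show ?thesis using p by auto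
  qed
qed

text \<open>\<open>C < 2 * p\<close> forces \<open>p \<le> x * y\<close>, hence
  \<open>4 * p \<le> (x + y)\<^sup>2\<close>; it also gives \<open>x + y \<le> 3 * d\<close> through
  \<open>dC\<close>.\<close>

lemma gap_bound_diff_ge_3:
  fixes p d x y C :: int
  assumes p: "p \<ge> 3" and d: "d > 0" and x: "x > 0" and y: "y > 0" and z: "x - y \<ge> 3"
    and C: "C = p * (x - y) - x * y" "C < 2 * p"
    and dC: "d * C = (p - 1) * (x + y)"
  shows "4 * p \<le> 11 * d\<^sup>2"
proof -
  have "p * 3 \<le> p * (x - y)" using p z by (intro mult_left_mono) auto
  then have "p \<le> x * y" using C by simp
  moreover have "(x + y)\<^sup>2 = (x - y)\<^sup>2 + 4 * (x * y)"
    by (simp add: algebra_simps power2_eq_square)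
  ultimately have F2: "4 * p \<le> (x + y)\<^sup>2" by (smt (verit) zero_le_power2)
  \<comment> \<open>\<open>2 * p \<le> 3 * (p - 1)\<close> because \<open>p \<ge> 3\<close>.\<close>
  have "2 * p * (x + y) \<le> 3 * (p - 1) * (x + y)"
    using p x y by (intro mult_right_mono) auto
  also have "\<dots> = 3 * (d * C)" unfolding dC by simp
  also have "\<dots> \<le> 3 * (d * (2 * p))" using C d by (intro mult_left_mono) auto
  finally have "2 * p * (x + y) \<le> 2 * p * (3 * d)" by (simp add: algebra_simps)
  then have "x + y \<le> 3 * d" using p by simp
  then have "(x + y)\<^sup>2 \<le> (3 * d)\<^sup>2" using x y by (intro power_mono) auto
  then have "(x + y)\<^sup>2 \<le> 9 * d\<^sup>2" by (simp add: power_mult_distrib)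
  then show ?thesis using F2 zero_le_power2[of d] by linarith
qed

lemma K3N_gap_bound:
  assumes "K3N n p q r"
  shows "4 * p \<le> 11 * (r - q)\<^sup>2"
proof -
  have "1 < p" "odd p" and qr: "q < r" using assms by (auto simp: K3N_def)
  then have p: "p \<ge> 3" by presburger
  obtain x y C A :: int where x: "x > 0" and y: "y > 0" and Cpos: "C > 0"
    and C: "C = p * (x - y) - x * y" "C < 2 * p"
    and dC: "(r - q) * C = (p - 1) * (x + y)"
    and AC: "A * C\<^sup>2 = (4 * p + (x - y)) * (p\<^sup>2 - p + C) + (p - 1) * C"
    using K3N_parameters[OF assms] .
  have "p * (x - y) > 0" using C Cpos x y by (smt (verit) mult_pos_pos)
  then have "x - y > 0" using p by (simp add: zero_less_mult_iff)
  then consider "x = y + 1" | "x = y + 2" | "x - y \<ge> 3" by linarith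
  then show ?thesis
  proof cases
    case 1
    show ?thesis
      by (rule gap_bound_diff_1[OF y Cpos]) (use C dC AC 1 in \<open>simp_all add: algebra_simps\<close>)
  next
    case 2
    show ?thesis
      by (rule gap_bound_diff_2[OF y Cpos]) (use C dC AC 2 in \<open>simp_all add: algebra_simps\<close>)
  next
    case 3
    show ?thesis
      using gap_bound_diff_ge_3[OF p _ x y 3 C dC] qr by simp
  qed
qed

theorem theorem4p5:
  fixes n p q r :: int
  assumes "K3N n p q r"
  shows "real_of_int q < sqrt (real_of_int n / real_of_int p) - sqrt (real_of_int p / 12)"
proof -
  have n: "n = p * q * r" and pqr: "1 < p" "p < q" "q < r" and "odd q" "odd r"
    using assms by (auto simp: K3N_def)
  \<comment> \<open>Distinct odd numbers differ by at least 2.\<close>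
  then have d: "r - q \<ge> 2" by presburger
  define P Q d' s :: real where "P = p" and "Q = q" and "d' = r - q" and "s = sqrt (P / 12)"
  have pos: "P > 0" "P < Q" "Q > 0" "d' \<ge> 2"
    using pqr d unfolding P_def Q_def d'_def by linarith+
  have "real_of_int (4 * p) \<le> real_of_int (11 * (r - q)\<^sup>2)"
    using K3N_gap_bound[OF assms] by (simp only: of_int_le_iff)
  then have gap: "4 * P \<le> 11 * d'\<^sup>2" by (simp add: P_def d'_def)
  \<comment> \<open>The gap bound gives \<open>s\<^sup>2 \<le> 11 / 48 * d'\<^sup>2\<close>, and
    \<open>11 / 48 = 528 / 2304\<close> is just below \<open>(23 / 48)\<^sup>2\<close>. As
    \<open>23 / 48 < 1 / 2\<close>, a margin of \<open>Q * d' / 24\<close> is left to absorb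
    \<open>s\<^sup>2\<close>.\<close>
  have "s \<le> 23 / 48 * d'"
    unfolding s_def
  proof (rule real_le_lsqrt)
    have "(23 / 48 * d')\<^sup>2 = 529 / 2304 * d'\<^sup>2"
      by (simp add: power_mult_distrib power_divide)
    then show "P / 12 \<le> (23 / 48 * d')\<^sup>2"
      using gap zero_le_power2[of d'] by linarith
  qed (use pos in auto)
  then have "2 * Q * s \<le> 2 * Q * (23 / 48 * d')" using pos by (intro mult_left_mono) auto
  moreover have "P / 12 < Q * d' / 24"
  proof -
    have "Q * 2 \<le> Q * d'" using pos by (intro mult_left_mono) auto
    then show ?thesis using pos by linarith
  qed
  moreover have "s\<^sup>2 = P / 12" using pos by (simp add: s_def)
  \<comment> \<open>Expanded, this is \<open>2 * Q * s + s\<^sup>2 < Q * d'\<close>.\<close>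
  ultimately have "(Q + s)\<^sup>2 < Q * (Q + d')"
    by (simp add: algebra_simps power2_eq_square)
  then have "Q + s < sqrt (Q * (Q + d'))" by (rule real_less_rsqrt)
  moreover have "real_of_int n / real_of_int p = Q * (Q + d')"
    using pqr unfolding n Q_def d'_def by simp
  ultimately show ?thesis by (simp add: P_def Q_def s_def)
qed

end
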